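(* Let $k\subseteq\mathbb C$ be a field containing $\sqrt5$. For any $m,n\in k$, let $C/k$ be the curve with Weierstrass model $$\begin{aligned}y^2=\;&(m-n\sqrt5)^2x^6-2(m^2-5n^2)(m-n\sqrt5)x^5-10(m^2-5n^2)(m^2-5n^2-5)x^3\\&-2(m^2-5n^2)(m^2-5n^2-5)^2(m+n\sqrt5)x-(m^2-5n^2-5)^3(m+n\sqrt5)^2.\end{aligned}$$ When $C$ is a genus $2$ curve, the Igusa--Clebsch invariants $(I_2:I_4:I_6:I_{10})$ of $C$ are, writing $\nu=m^2-5n^2$, $$\bigl(20(2\nu-3) : 25(\nu-9)^2 : 5(75\nu^3+72m\nu^2-1165\nu^2-360m\nu+5985\nu-6399) : 8(m\nu^2+5\nu^2-5m\nu-45\nu+108)^2\bigr),$$ i.e. $C$ corresponds to the point $(m,n)$ in the $\mathbb P^2_{m,n}$ birational model of the Hilbert modular surface $Y_-(5)$.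
   Context: Igusa--Clebsch invariants: for a genus $2$ curve $y^2=f(x)$, $f$ a sextic with leading coefficient $a$ and roots $x_1,\dots,x_6$ (with $(ij)=x_i-x_j$), $I_2=a^2\sum(12)^2(34)^2(56)^2$ (15 terms), $I_4=a^4\sum(12)^2(23)^2(31)^2(45)^2(56)^2(64)^2$ (10 terms), $I_6=a^6\sum(12)^2(23)^2(31)^2(45)^2(56)^2(64)^2(14)^2(25)^2(36)^2$ (60 terms), $I_{10}=a^{10}\prod_{i<j}(ij)^2=\mathrm{disc}(f)$ (these are polynomials in the coefficients of the binary sextic, so also make sense when the $x^6$-coefficient vanishes). They are considered as a point of weighted projective space $\mathbb P^3_{1,2,3,5}(\mathbb C)$, i.e. up to $(I_2,I_4,I_6,I_{10})\sim(\lambda I_2,\lambda^2I_4,\lambda^3I_6,\lambda^5I_{10})$, $\lambda\in\mathbb C^\times$. $Y_-(5)$ is the Hilbert modular surface parametrizing principally polarized abelian surfaces with real multiplication by $\mathbb Z[\frac{1+\sqrt5}2]$; the meaning of "corresponds to the point $(m,n)$" is exactly that the Igusa--Clebsch invariants are as displayed. *)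

theory Defs
  imports
    "HOL-Algebra.Algebraic_Closure_Type"
    "HOL-Combinatorics.Permutations"
    "HOL-Computational_Algebra.Computational_Algebra"
begin

text \<open>
  The expressions in the brackets \<open>(ij) = d i j\<close> of six points that define
  \<open>(I\<^sub>2, I\<^sub>4, I\<^sub>6, I\<^sub>1\<^sub>0)\<close>.  The classical sums run over the distinct terms obtained from the
  displayed one by permuting the six points.  Its stabilizer in the symmetric group has order
  48, 72 and 12, respectively, so dividing the sum over all 720 permutations by this order
  gives the sum of the 15, 10 and 60 distinct terms.
\<close>

definition igusa_clebsch_sums ::
    "(nat \<Rightarrow> nat \<Rightarrow> complex) \<Rightarrow> complex \<times> complex \<times> complex \<times> complex" where
  "igusa_clebsch_sums d =
    ((\<Sum>\<sigma> | \<sigma> permutes {1..6}. let b = (\<lambda>i j. d (\<sigma> i) (\<sigma> j)) in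
        (b 1 2)\<^sup>2 * (b 3 4)\<^sup>2 * (b 5 6)\<^sup>2) / 48,
     (\<Sum>\<sigma> | \<sigma> permutes {1..6}. let b = (\<lambda>i j. d (\<sigma> i) (\<sigma> j)) in
        (b 1 2)\<^sup>2 * (b 2 3)\<^sup>2 * (b 3 1)\<^sup>2 * (b 4 5)\<^sup>2 * (b 5 6)\<^sup>2 * (b 6 4)\<^sup>2) / 72,
     (\<Sum>\<sigma> | \<sigma> permutes {1..6}. let b = (\<lambda>i j. d (\<sigma> i) (\<sigma> j)) in
        (b 1 2)\<^sup>2 * (b 2 3)\<^sup>2 * (b 3 1)\<^sup>2 * (b 4 5)\<^sup>2 * (b 5 6)\<^sup>2 * (b 6 4)\<^sup>2
          * (b 1 4)\<^sup>2 * (b 2 5)\<^sup>2 * (b 3 6)\<^sup>2) / 12,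
     (\<Prod>j\<in>{1..6}. \<Prod>i\<in>{1..<j}. (d i j)\<^sup>2))"

text \<open>
  A polynomial \<open>f\<close> of degree at most 6 is regarded as the binary sextic
  \<open>z\<^sup>6 f(x/z) = \<Prod>\<^sub>i (u\<^sub>i x - v\<^sub>i z)\<close>, with brackets \<open>(ij) = v\<^sub>i u\<^sub>j - v\<^sub>j u\<^sub>i\<close>.
  In this form the invariants also make sense when the coefficient of \<open>x\<^sup>6\<close> vanishes
  (some \<open>u\<^sub>i = 0\<close>, a root at infinity).  The choice of the factorization is immaterial
  (lemma \<open>igusa_clebsch_eqI\<close>), and in degree 6 the formulas in terms of the leading coefficient
  and the roots are recovered (lemma \<open>igusa_clebsch_roots\<close>).
\<close>

definition sextic_factorization :: "complex poly \<Rightarrow> (nat \<Rightarrow> complex) \<Rightarrow> (nat \<Rightarrow> complex) \<Rightarrow> bool" where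
  "sextic_factorization f u v \<longleftrightarrow> f = (\<Prod>i\<in>{1..6}. [:- v i, u i:])"

definition igusa_clebsch :: "complex poly \<Rightarrow> complex \<times> complex \<times> complex \<times> complex" where
  "igusa_clebsch f =
    (let (u, v) = (SOME (u, v). sextic_factorization f u v)
     in igusa_clebsch_sums (\<lambda>i j. v i * u j - v j * u i))"

text \<open>Equality of the points with the given coordinates in the weighted projective space
  \<open>\<bbbP>\<^sup>3\<close> with weights 1, 2, 3, 5; in particular, both tuples have to be nonzero.\<close>

definition same_point_1235 ::
    "complex \<times> complex \<times> complex \<times> complex \<Rightarrow> complex \<times> complex \<times> complex \<times> complex \<Rightarrow> bool" where
  "same_point_1235 P Q \<longleftrightarrow> P \<noteq> (0, 0, 0, 0) \<and> Q \<noteq> (0, 0, 0, 0) \<and>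
    (\<exists>c. c \<noteq> 0 \<and> (case P of (a1, a2, a3, a5) \<Rightarrow> Q = (c * a1, c^2 * a2, c^3 * a3, c^5 * a5)))"

text \<open>In characteristic 0, the smooth projective model of \<open>y\<^sup>2 = f(x)\<close> with \<open>deg f \<le> 6\<close> has
  genus 2 iff \<open>f\<close> has degree 5 or 6 and no repeated root.\<close>

definition genus2_weierstrass :: "complex poly \<Rightarrow> bool" where
  "genus2_weierstrass f \<longleftrightarrow> squarefree f \<and> Polynomial.degree f \<in> {5, 6}"

definition weierstrass_sextic :: "complex \<Rightarrow> complex \<Rightarrow> complex poly" where
  "weierstrass_sextic m n =
    (let r = complex_of_real (sqrt 5) in
      [: - ((m^2 - 5 * n^2 - 5)^3 * (m + n * r)^2),
         - (2 * (m^2 - 5 * n^2) * (m^2 - 5 * n^2 - 5)^2 * (m + n * r)),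
         0,
         - (10 * (m^2 - 5 * n^2) * (m^2 - 5 * n^2 - 5)),
         0,
         - (2 * (m^2 - 5 * n^2) * (m - n * r)),
         (m - n * r)^2 :])"


subsection \<open>The invariants are well defined\<close>

lemma ivl6: "{1..6::nat} = {1,2,3,4,5,6}"
  by auto

lemma ex_sextic_factorization:
  assumes "Polynomial.degree f \<le> 6"
  shows "\<exists>u v. sextic_factorization f u v"
proof -
  obtain xs where xs: "mset xs = proots f"
    using ex_mset by blast
  have len: "length xs \<le> 6"
    using assms size_proots_complex[of f] xs by (metis size_mset)
  have f: "f = smult (lead_coeff f) (\<Prod>i<length xs. [:- xs ! i, 1:])"
  proof -
    have "(\<Prod>x\<in>#mset xs. [:- x, 1:]) = (\<Prod>i<length xs. [:- xs ! i, 1:])"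
      unfolding mset_map[symmetric] prod_mset_prod_list
      by (simp add: prod.list_conv_set_nth atLeast0LessThan)
    thus ?thesis
      using complex_poly_decompose_multiset[of f] xs by simp
  qed
  define g where "g i = (if i < length xs then [:- xs ! i, 1:] else [:-(-1), 0:])" for i
  define c where "c i = (if i = 0 then lead_coeff f else 1)" for i :: nat
  have "f = [:lead_coeff f:] * (\<Prod>i<6. g i)"
  proof -
    have "(\<Prod>i<6. g i) = (\<Prod>i<length xs. g i)"
      by (rule prod.mono_neutral_right) (use len in \<open>auto simp: g_def one_pCons\<close>)
    thus ?thesis
      using f by (simp add: g_def)
  qed
  also have "[:lead_coeff f:] = (\<Prod>i<6. [:c i:])"
    by (simp add: c_def eval_nat_numeral one_pCons)
  also have "(\<Prod>i<6. [:c i:]) * (\<Prod>i<6. g i) = (\<Prod>i<6. [:c i:] * g i)"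
    by (rule prod.distrib[symmetric])
  also have "\<dots> = (\<Prod>i\<in>{1..6}. [:c (i - 1):] * g (i - 1))"
    by (rule prod.reindex_bij_witness[of _ "\<lambda>i. i - 1" Suc]) auto
  also have "\<dots> = (\<Prod>i\<in>{1..6}.
      [:- (c (i - 1) * (if i - 1 < length xs then xs ! (i - 1) else -1)),
        c (i - 1) * (if i - 1 < length xs then 1 else 0):])"
    by (rule prod.cong) (auto simp: g_def)
  finally show ?thesis
    unfolding sextic_factorization_def by (intro exI)
qed

lemma mset_proj_roots:
  fixes u v :: "'i \<Rightarrow> complex"
  assumes "finite A" "(\<Prod>i\<in>A. [:- v i, u i:]) \<noteq> 0"
  shows "Polynomial.degree (\<Prod>i\<in>A. [:- v i, u i:]) \<le> card A \<and>
    image_mset (\<lambda>i. if u i = 0 then None else Some (v i / u i)) (mset_set A) =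
    image_mset Some (proots (\<Prod>i\<in>A. [:- v i, u i:])) +
      replicate_mset (card A - Polynomial.degree (\<Prod>i\<in>A. [:- v i, u i:])) None"
  using assms
proof (induction A rule: finite_induct)
  case empty
  show ?case by simp
next
  case (insert a A)
  define F where "F = (\<Prod>i\<in>A. [:- v i, u i:])"
  have F: "(\<Prod>i\<in>insert a A. [:- v i, u i:]) = [:- v a, u a:] * F"
    using insert by (simp add: F_def)
  hence nz: "[:- v a, u a:] \<noteq> 0" "F \<noteq> 0"
    using insert.prems by auto
  note IH = insert.IH[folded F_def, OF nz(2)]
  show ?case
  proof (cases "u a = 0")
    case True
    hence va: "v a \<noteq> 0" using nz by auto
    have "[:- v a, u a:] * F = smult (- v a) F"
      using True by simp
    hence "proots ([:- v a, u a:] * F) = proots F"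
      "Polynomial.degree ([:- v a, u a:] * F) = Polynomial.degree F"
      using va proots_smult[of "- v a" F] degree_smult_eq[of "- v a" F] by (simp_all del: mult_pCons_left)
    moreover have "Suc (card A) - Polynomial.degree F = Suc (card A - Polynomial.degree F)"
      using IH by (simp add: Suc_diff_le)
    ultimately show ?thesis
      unfolding F using insert.hyps IH True by simp
  next
    case False
    have "[:- v a, u a:] = smult (u a) [:- (v a / u a), 1:]"
      using False by simp
    hence "proots [:- v a, u a:] = {#v a / u a#}"
      using False by (metis minus_minus proots_linear_factor proots_smult)
    hence "proots ([:- v a, u a:] * F) = {#v a / u a#} + proots F"
      by (simp only: proots_mult[OF nz])
    moreover have "Polynomial.degree ([:- v a, u a:] * F) = Suc (Polynomial.degree F)"
      using degree_mult_eq[OF nz] False by simp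
    ultimately show ?thesis
      unfolding F using insert.hyps IH False by simp
  qed
qed

lemma scale_aux2:
  "(c1 * c2 * d12) ^ 2 * (c3 * c4 * d34) ^ 2 * (c5 * c6 * d56) ^ 2
    = (c1 * c2 * c3 * c4 * c5 * c6) ^ 2 * (d12^2 * d34^2 * (d56::complex) ^ 2)"
  by (simp add: power_mult_distrib mult_ac)

lemma scale_aux4:
  "(c1 * c2 * d12) ^ 2 * (c2 * c3 * d23) ^ 2 * (c3 * c1 * d31) ^ 2 * (c4 * c5 * d45) ^ 2 * (c5 * c6 * d56) ^ 2 * (c6 * c4 * d64) ^ 2
    = (c1 * c2 * c3 * c4 * c5 * c6) ^ 4 * (d12^2 * d23^2 * d31^2 * d45^2 * d56^2 * (d64::complex) ^ 2)"
  by Groebner_Basis.algebra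

lemma scale_aux6:
  "(c1 * c2 * d12) ^ 2 * (c2 * c3 * d23) ^ 2 * (c3 * c1 * d31) ^ 2 * (c4 * c5 * d45) ^ 2 * (c5 * c6 * d56) ^ 2 * (c6 * c4 * d64) ^ 2 * (c1 * c4 * d14) ^ 2 * (c2 * c5 * d25) ^ 2 * (c3 * c6 * d36) ^ 2

    = (c1 * c2 * c3 * c4 * c5 * c6) ^ 6 * (d12^2 * d23^2 * d31^2 * d45^2 * d56^2 * d64^2 * d14^2 * d25^2 * (d36::complex) ^ 2)"
  by Groebner_Basis.algebra

lemma scale_aux10:
  "(c1 * c2) ^ 2 * ((c1 * c3) ^ 2 * (c2 * c3) ^ 2) * ((c1 * c4) ^ 2 * (c2 * c4) ^ 2 * (c3 * c4) ^ 2) * ((c1 * c5) ^ 2 * (c2 * c5) ^ 2 * (c3 * c5) ^ 2 * (c4 * c5) ^ 2) * ((c1 * c6) ^ 2 * (c2 * c6) ^ 2 * (c3 * c6) ^ 2 * (c4 * c6) ^ 2 * (c5 * c6) ^ 2)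
    = (c1 * c2 * c3 * c4 * c5 * c6::complex) ^ 10"
  by Groebner_Basis.algebra

lemma igusa_clebsch_sums_scale:
  "igusa_clebsch_sums (\<lambda>i j. c i * c j * d i j) =
    (case igusa_clebsch_sums d of (s2, s4, s6, s10) \<Rightarrow>
      let P = (\<Prod>i\<in>{1..6}. c i) in (P^2 * s2, P^4 * s4, P^6 * s6, P^10 * s10))"
proof -
  define P where "P = (\<Prod>i\<in>{1..6}. c i)"
  have c: "c (\<sigma> 1) * c (\<sigma> 2) * c (\<sigma> 3) * c (\<sigma> 4) * c (\<sigma> 5) * c (\<sigma> 6) = P"
    if "\<sigma> permutes {1..6}" for \<sigma>
  proof -
    have "(\<Prod>i\<in>{1..6}. c (\<sigma> i)) = P"
      using prod.permute[OF that, of c] by (simp add: P_def o_def)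
    thus ?thesis unfolding ivl6 by (simp add: mult_ac)
  qed
  have "(\<Prod>j\<in>{1..6}. \<Prod>i\<in>{1..<j}. (c i * c j * d i j)\<^sup>2) =
      (\<Prod>j\<in>{1..6}. \<Prod>i\<in>{1..<j}. (c i * c j)\<^sup>2) * (\<Prod>j\<in>{1..6}. \<Prod>i\<in>{1..<j}. (d i j)\<^sup>2)"
    by (simp add: prod.distrib power_mult_distrib)
  also have "(\<Prod>j\<in>{1..6}. \<Prod>i\<in>{1..<j}. (c i * c j)\<^sup>2) = P ^ 10"
  proof -
    have ivls: "{1..<1} = ({}::nat set)" "{1..<2} = {1::nat}" "{1..<3} = {1,2::nat}"
      "{1..<4} = {1,2,3::nat}" "{1..<5} = {1,2,3,4::nat}" "{1..<6} = {1,2,3,4,5::nat}"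
      by auto
    have "(\<Prod>j\<in>{1..6}. \<Prod>i\<in>{1..<j}. (c i * c j)\<^sup>2) =
      (c 1 * c 2)\<^sup>2 * ((c 1 * c 3)\<^sup>2 * (c 2 * c 3)\<^sup>2) * ((c 1 * c 4)\<^sup>2 * (c 2 * c 4)\<^sup>2 * (c 3 * c 4)\<^sup>2)
      * ((c 1 * c 5)\<^sup>2 * (c 2 * c 5)\<^sup>2 * (c 3 * c 5)\<^sup>2 * (c 4 * c 5)\<^sup>2)
      * ((c 1 * c 6)\<^sup>2 * (c 2 * c 6)\<^sup>2 * (c 3 * c 6)\<^sup>2 * (c 4 * c 6)\<^sup>2 * (c 5 * c 6)\<^sup>2)"
      unfolding ivl6 by (simp add: ivls mult.assoc del: One_nat_def)
    thus ?thesis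
      using c[OF permutes_id] by (simp only: scale_aux10 id_apply)
  qed
  finally have disc: "(\<Prod>j\<in>{1..6}. \<Prod>i\<in>{1..<j}. (c i * c j * d i j)\<^sup>2) =
      P ^ 10 * (\<Prod>j\<in>{1..6}. \<Prod>i\<in>{1..<j}. (d i j)\<^sup>2)" .
  show ?thesis
    unfolding igusa_clebsch_sums_def Let_def prod.case P_def[symmetric]
      times_divide_eq_right sum_distrib_left
    by (intro arg_cong2[where f = Pair] arg_cong2[where f = "(/)"] sum.cong refl disc;
        subst scale_aux2 scale_aux4 scale_aux6; simp only: mem_Collect_eq c)
qed

lemma igusa_clebsch_sums_permute:
  assumes p: "p permutes {1..6}" and d: "\<And>i j. d j i = - d i j"
  shows "igusa_clebsch_sums (\<lambda>i j. d (p i) (p j)) = igusa_clebsch_sums d"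
proof -
  have sums: "(\<Sum>\<sigma> | \<sigma> permutes {1..6}. f (\<lambda>i. p (\<sigma> i))) = (\<Sum>\<sigma> | \<sigma> permutes {1..6}. f \<sigma>)"
    for f :: "(nat \<Rightarrow> nat) \<Rightarrow> complex"
    using setum_permutations_compose_left[OF p, of f] by (simp add: o_def)
  define D where "D = {(i, j). i \<in> {1..6::nat} \<and> j \<in> {1..6::nat} \<and> i \<noteq> j}"
  have D: "D = {(i, j). i \<in> {1..6} \<and> j \<in> {1..6} \<and> i < j} \<union>
      {(i, j). i \<in> {1..6} \<and> j \<in> {1..6} \<and> j < i}" (is "_ = ?L \<union> ?G")
    by (auto simp: D_def)
  have fin: "finite ?L" "finite ?G"
    by (rule finite_subset[of _ "{1..6} \<times> {1..6}"]; auto)+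
  have *: "(\<Prod>j\<in>{1..6::nat}. \<Prod>i\<in>{1..<j}. (e i j)\<^sup>2) = (- 1) ^ card ?L * (\<Prod>(i, j)\<in>D. e i j)"
    if e: "\<And>i j. e j i = - e i j" for e :: "nat \<Rightarrow> nat \<Rightarrow> complex"
  proof -
    have "(\<Prod>(i, j)\<in>?G. e i j) = (\<Prod>(i, j)\<in>?L. e j i)"
      by (rule prod.reindex_bij_witness[of _ "\<lambda>(i, j). (j, i)" "\<lambda>(i, j). (j, i)"]) auto
    moreover have "(\<Prod>(i, j)\<in>D. e i j) = (\<Prod>(i, j)\<in>?L. e i j) * (\<Prod>(i, j)\<in>?G. e i j)"
      unfolding D by (rule prod.union_disjoint) (use fin in auto)
    ultimately have "(\<Prod>(i, j)\<in>D. e i j) = (\<Prod>x\<in>?L. (case x of (i, j) \<Rightarrow> e i j) * (case x of (i, j) \<Rightarrow> e j i))"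
      by (simp only: prod.distrib)
    also have "\<dots> = (\<Prod>x\<in>?L. - 1 * (case x of (i, j) \<Rightarrow> (e i j)\<^sup>2))"
    proof (rule prod.cong)
      fix x assume "x \<in> ?L"
      show "(case x of (i, j) \<Rightarrow> e i j) * (case x of (i, j) \<Rightarrow> e j i) = - 1 * (case x of (i, j) \<Rightarrow> (e i j)\<^sup>2)"
        by (cases x; simp add: power2_eq_square) (metis e mult_minus_right)
    qed simp
    also have "\<dots> = (- 1) ^ card ?L * (\<Prod>(i, j)\<in>?L. (e i j)\<^sup>2)"
      unfolding prod.distrib by simp
    also have "(\<Prod>(i, j)\<in>?L. (e i j)\<^sup>2) = (\<Prod>(j, i)\<in>(SIGMA j:{1..6}. {1..<j}). (e i j)\<^sup>2)"
      by (rule prod.reindex_bij_witness[of _ "\<lambda>(i, j). (j, i)" "\<lambda>(i, j). (j, i)"]) auto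
    also have "\<dots> = (\<Prod>j\<in>{1..6::nat}. \<Prod>i\<in>{1..<j}. (e i j)\<^sup>2)"
      by (rule prod.Sigma[symmetric]) auto
    finally show ?thesis
      by (simp flip: power_add mult.assoc)
  qed
  have "(\<Prod>(i, j)\<in>D. d (p i) (p j)) = (\<Prod>(i, j)\<in>D. d i j)"
    by (rule prod.reindex_bij_witness[of _ "\<lambda>(i, j). (inv_into UNIV p i, inv_into UNIV p j)" "\<lambda>(i, j). (p i, p j)"])
       (use p permutes_inv[OF p] in \<open>auto simp: D_def permutes_inverses permutes_in_image
          inj_eq[OF permutes_inj] simp del: atLeastAtMost_iff\<close>)
  hence "(\<Prod>j\<in>{1..6::nat}. \<Prod>i\<in>{1..<j}. (d (p i) (p j))\<^sup>2) = (\<Prod>j\<in>{1..6}. \<Prod>i\<in>{1..<j}. (d i j)\<^sup>2)"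
    using *[of "\<lambda>i j. d (p i) (p j)", OF d] *[of d, OF d] by simp
  thus ?thesis
    unfolding igusa_clebsch_sums_def Let_def
    by (intro arg_cong2[where f = Pair] arg_cong2[where f = "(/)"] refl)
       (assumption | rule sums)+
qed

lemma igusa_clebsch_sums_unique:
  assumes f: "f \<noteq> 0" and uv: "sextic_factorization f u v" and uv': "sextic_factorization f u' v'"
  shows "igusa_clebsch_sums (\<lambda>i j. v i * u j - v j * u i) =
    igusa_clebsch_sums (\<lambda>i j. v' i * u' j - v' j * u' i)"
proof -
  define r where "r u v i = (if u i = 0 then None else Some (v i / u i))"
    for u v :: "nat \<Rightarrow> complex" and i
  have "image_mset (r u v) (mset_set {1..6}) = image_mset (r u' v') (mset_set {1..6})"
    using mset_proj_roots[of "{1..6}" v u] mset_proj_roots[of "{1..6}" v' u'] f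
    unfolding r_def uv[unfolded sextic_factorization_def, symmetric]
      uv'[unfolded sextic_factorization_def, symmetric] by simp
  then obtain p where p: "p permutes {1..6}" and rp: "\<forall>i\<in>{1..6}. r u v i = r u' v' (p i)"
    using image_mset_eq_implies_permutes[of "{1..6::nat}"] by (metis finite_atLeastAtMost)
  have nz: "u i \<noteq> 0 \<or> v i \<noteq> 0" if "i \<in> {1..6}" "sextic_factorization f u v" for i u v
  proof -
    have "[:- v i, u i:] dvd f"
      using that by (auto simp: sextic_factorization_def intro!: dvd_prodI)
    thus ?thesis using f by auto
  qed
  have "\<exists>c. u i = c * u' (p i) \<and> v i = c * v' (p i)" if i: "i \<in> {1..6}" for i
  proof (cases "u i = 0")
    case True
    hence "u' (p i) = 0"
      using rp i by (auto simp: r_def split: if_splits)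
    moreover have "v' (p i) \<noteq> 0"
      using nz[OF _ uv', of "p i"] p i calculation by (simp add: permutes_in_image del: atLeastAtMost_iff)
    ultimately show ?thesis
      using True by (intro exI[of _ "v i / v' (p i)"]) simp
  next
    case False
    hence "u' (p i) \<noteq> 0" "v i / u i = v' (p i) / u' (p i)"
      using rp i by (auto simp: r_def split: if_splits)
    thus ?thesis
      using False by (intro exI[of _ "u i / u' (p i)"]) (simp add: field_simps)
  qed
  then obtain c where c: "\<And>i. i \<in> {1..6} \<Longrightarrow> u i = c i * u' (p i) \<and> v i = c i * v' (p i)"
    by metis
  have "f = (\<Prod>i\<in>{1..6}. smult (c i) [:- v' (p i), u' (p i):])"
    using uv c unfolding sextic_factorization_def by (auto intro!: prod.cong)
  also have "\<dots> = smult (\<Prod>i\<in>{1..6}. c i) (\<Prod>i\<in>{1..6}. [:- v' (p i), u' (p i):])"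
    by (rule prod_smult)
  also have "(\<Prod>i\<in>{1..6}. [:- v' (p i), u' (p i):]) = f"
    using prod.permute[OF p, of "\<lambda>i. [:- v' i, u' i:]"] uv'
    by (simp add: sextic_factorization_def o_def)
  finally have "f = smult (\<Prod>i\<in>{1..6}. c i) f" .
  hence c1: "(\<Prod>i\<in>{1..6}. c i) = 1"
    using f by (metis lead_coeff_smult leading_coeff_0_iff mult_cancel_right1)
  let ?d = "\<lambda>i j. v' i * u' j - v' j * u' i"
  have cong: "igusa_clebsch_sums d = igusa_clebsch_sums d'"
    if "\<And>i j. i \<in> {1..6} \<Longrightarrow> j \<in> {1..6} \<Longrightarrow> d i j = d' i j" for d d'
  proof -
    have "d (\<sigma> i) (\<sigma> j) = d' (\<sigma> i) (\<sigma> j)"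
      if "\<sigma> permutes {1..6}" "i \<in> {1..6}" "j \<in> {1..6}" for \<sigma> i j
      using that \<open>\<And>i j. i \<in> {1..6} \<Longrightarrow> j \<in> {1..6} \<Longrightarrow> d i j = d' i j\<close> permutes_in_image by metis
    thus ?thesis
      unfolding igusa_clebsch_sums_def Let_def
      by (intro arg_cong2[where f = Pair] arg_cong2[where f = "(/)"] refl sum.cong prod.cong)
         (auto simp: that)
  qed
  have "igusa_clebsch_sums (\<lambda>i j. v i * u j - v j * u i) =
      igusa_clebsch_sums (\<lambda>i j. c i * c j * ?d (p i) (p j))"
    by (rule cong) (simp add: c algebra_simps del: atLeastAtMost_iff)
  also have "\<dots> = igusa_clebsch_sums (\<lambda>i j. ?d (p i) (p j))"
    unfolding igusa_clebsch_sums_scale c1 by (simp split: prod.splits)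
  also have "\<dots> = igusa_clebsch_sums ?d"
    by (rule igusa_clebsch_sums_permute[OF p]) simp
  finally show ?thesis .
qed

lemma igusa_clebsch_eqI:
  assumes "f \<noteq> 0" "sextic_factorization f u v"
  shows "igusa_clebsch f = igusa_clebsch_sums (\<lambda>i j. v i * u j - v j * u i)"
proof -
  have "case (SOME (u, v). sextic_factorization f u v) of (u, v) \<Rightarrow> sextic_factorization f u v"
    by (rule someI[of _ "(u, v)"]) (use assms in simp)
  thus ?thesis
    unfolding igusa_clebsch_def Let_def
    by (auto split: prod.splits intro!: igusa_clebsch_sums_unique[OF assms(1) _ assms(2)])
qed

lemma igusa_clebsch_roots:
  assumes "a \<noteq> 0" "f = smult a (\<Prod>i\<in>{1..6}. [:- x i, 1:])"
  shows "igusa_clebsch f = (case igusa_clebsch_sums (\<lambda>i j. x i - x j) of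
    (s2, s4, s6, s10) \<Rightarrow> (a^2 * s2, a^4 * s4, a^6 * s6, a^10 * s10))"
proof -
  define c where "c i = (if i = 1 then a else 1)" for i :: nat
  have c: "(\<Prod>i\<in>{1..6}. c i) = a"
    unfolding ivl6 by (simp add: c_def)
  have "f \<noteq> 0" using assms by auto
  moreover have "sextic_factorization f c (\<lambda>i. c i * x i)"
  proof -
    have "(\<Prod>i\<in>{1..6}. [:- (c i * x i), c i:]) = (\<Prod>i\<in>{1..6}. smult (c i) [:- x i, 1:])"
      by simp
    also have "\<dots> = smult (\<Prod>i\<in>{1..6}. c i) (\<Prod>i\<in>{1..6}. [:- x i, 1:])"
      by (rule prod_smult)
    finally show ?thesis
      unfolding sextic_factorization_def c assms(2) by simp
  qed
  ultimately have "igusa_clebsch f = igusa_clebsch_sums (\<lambda>i j. c i * x i * c j - c j * x j * c i)"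
    by (rule igusa_clebsch_eqI)
  also have "(\<lambda>i j. c i * x i * c j - c j * x j * c i) = (\<lambda>i j. c i * c j * (x i - x j))"
    by (simp add: algebra_simps fun_eq_iff)
  finally show ?thesis
    unfolding igusa_clebsch_sums_scale c Let_def .
qed

lemma weierstrass_sextic_over_subfield:
  assumes k: "subfield k (ring_of_type_algebra :: complex ring)"
    and "complex_of_real (sqrt 5) \<in> k" "m \<in> k" "n \<in> k"
  shows "set (coeffs (weierstrass_sextic m n)) \<subseteq> k"
proof -
  let ?R = "ring_of_type_algebra :: complex ring"
  have sr: "subring k ?R"
    using k by (auto dest: subfield.axioms subdomain.axioms subcring.axioms)
  have ops: "\<zero>\<^bsub>?R\<^esub> = 0" "\<one>\<^bsub>?R\<^esub> = 1" "x \<oplus>\<^bsub>?R\<^esub> y = x + y" "x \<otimes>\<^bsub>?R\<^esub> y = x * y" for x y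
    by (simp_all add: ring_of_type_algebra_def)
  have uminus: "\<ominus>\<^bsub>?R\<^esub> x = - x" for x
    unfolding a_inv_def m_inv_def ring_of_type_algebra_def
    by (auto intro!: the_equality simp: add_eq_0_iff)
  note closed = subringE[OF sr, unfolded ops uminus]
  have pow: "x ^ j \<in> k" if "x \<in> k" for x and j :: nat
    by (induction j) (auto intro: closed that)
  have num: "numeral w \<in> k" for w
    by (induction w) (auto intro: closed simp only: numeral.simps)
  have diff: "x - y \<in> k" if "x \<in> k" "y \<in> k" for x y
    using closed(7)[OF that(1) closed(5)[OF that(2)]] by simp
  show ?thesis
    using assms(2-4) unfolding weierstrass_sextic_def Let_def
    by (auto simp: coeffs_pCons_eq_cCons cCons_def split: if_splits
        intro!: closed diff pow num)
qed

end

theory Submission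
  imports Defs "HOL-Combinatorics.Multiset_Permutations"
begin

text \<open>
  With \<open>A = m + n \<surd>5\<close> and \<open>B = m - n \<surd>5\<close>, so that \<open>\<nu> = A B\<close>, the substitution \<open>x = A y\<close> turns the
  sextic into a multiple of \<open>F(y) = y\<^sup>6 - 2 y\<^sup>5 - 10 q y\<^sup>3 - 2 \<nu> q\<^sup>2 y - q\<^sup>2 (\<nu> - 5)\<close>, where
  \<open>q = (\<nu> - 5) / (A\<^sup>2 B)\<close>.  Moving a root \<open>s\<close> of \<open>F\<close> to infinity leaves a quintic whose coefficients
  are the Taylor coefficients of \<open>F\<close> at \<open>s\<close>.  For a sextic with a root at infinity the sums over
  permutations only involve the other five roots, and expanding them yields the invariants as
  explicit polynomials in the coefficients of the quintic.  At the Taylor coefficients of \<open>F\<close> these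
  become polynomials in \<open>s\<close>, \<open>q\<close> and \<open>\<nu>\<close>, from which \<open>s\<close> disappears modulo \<open>F(s) = 0\<close>.
\<close>

subsection \<open>Sums over permutations\<close>

text \<open>Sort the permutations by the preimage \<open>b\<close> of \<open>a\<close>. Right
  composition with \<open>g\<close> carries the stabilizer of \<open>a\<close> bijectively onto the
  class of \<open>b\<close> and preserves \<open>h\<close>, so every class has the same sum.\<close>

lemma sum_permutes_transitive:
  fixes h :: "('a \<Rightarrow> 'a) \<Rightarrow> 'b :: semiring_1"
  assumes S: "finite S" "a \<in> S"
    and g: "\<And>b. b \<in> S \<Longrightarrow> \<exists>g. g permutes S \<and> g b = a \<and> (\<forall>\<sigma>. h (\<sigma> \<circ> g) = h \<sigma>)"
  shows "(\<Sum>\<sigma> | \<sigma> permutes S. h \<sigma>) = of_nat (card S) * (\<Sum>\<sigma> | \<sigma> permutes S - {a}. h \<sigma>)"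
proof -
  have stab: "\<sigma> permutes S - {a} \<longleftrightarrow> \<sigma> permutes S \<and> \<sigma> a = a" for \<sigma>
    using permutes_subset[of \<sigma> "S - {a}" S] permutes_superset[of \<sigma> S "S - {a}"]
      permutes_not_in[of \<sigma> "S - {a}" a] by auto
  have "(\<Sum>\<sigma> | \<sigma> permutes S \<and> inv_into UNIV \<sigma> a = b. h \<sigma>) = (\<Sum>\<sigma> | \<sigma> permutes S - {a}. h \<sigma>)"
    if b: "b \<in> S" for b
  proof -
    obtain g where g: "g permutes S" "g b = a" "\<And>\<sigma>. h (\<sigma> \<circ> g) = h \<sigma>"
      using g[OF b] by blast
    have inv: "inv_into UNIV \<sigma> a = b \<longleftrightarrow> \<sigma> b = a" if "\<sigma> permutes S" for \<sigma>
      using permutes_inv_eq[OF that] by auto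
    have gb: "inv_into UNIV g a = b"
      using inv[OF g(1)] g(2) by simp
    have "h (\<sigma> \<circ> inv_into UNIV g) = h \<sigma>" for \<sigma>
      using g(3)[of "\<sigma> \<circ> inv_into UNIV g"] permutes_inv_o(2)[OF g(1)] by (simp add: o_assoc[symmetric])
    thus ?thesis
      by (intro sum.reindex_bij_witness[of _ "\<lambda>\<sigma>. \<sigma> \<circ> g" "\<lambda>\<sigma>. \<sigma> \<circ> inv_into UNIV g"])
         (auto simp: stab inv permutes_inverses permutes_compose permutes_inv g gb o_assoc[symmetric]
           permutes_inv_o[OF g(1)])
  qed
  moreover have "(\<Sum>\<sigma> | \<sigma> permutes S. h \<sigma>) =
      (\<Sum>b\<in>S. \<Sum>\<sigma> | \<sigma> permutes S \<and> inv_into UNIV \<sigma> a = b. h \<sigma>)"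
    using S
    by (intro sum.group[of "{\<sigma>. \<sigma> permutes S}" S "\<lambda>\<sigma>. inv_into UNIV \<sigma> a" h, simplified, symmetric])
       (auto simp: finite_permutations permutes_in_image[OF permutes_inv])
  ultimately show ?thesis
    by simp
qed

section \<open>Permutations enumerated as lists\<close>

lemma sum_permutes_set:
  fixes f :: "'a list \<Rightarrow> 'b :: comm_monoid_add"
  assumes "distinct xs"
  shows "(\<Sum>p | p permutes set xs. f (map p xs)) = (\<Sum>ys\<in>permutations_of_set (set xs). f ys)"
proof -
  let ?S = "{p. p permutes set xs}"
  have inj: "inj_on (\<lambda>p. map p xs) ?S"
  proof (rule inj_onI)
    fix p q assume "p \<in> ?S" "q \<in> ?S" "map p xs = map q xs"
    hence "p x = q x" for x
      by (cases "x \<in> set xs") (auto simp: permutes_not_in)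
    thus "p = q" by blast
  qed
  have "(\<lambda>p. map p xs) ` ?S = permutations_of_set (set xs)"
  proof (rule card_subset_eq)
    have "map p xs \<in> permutations_of_set (set xs)" if "p permutes set xs" for p
      using permutations_of_set_image_permutes[OF that] assms by (auto simp: permutations_of_setI)
    thus "(\<lambda>p. map p xs) ` ?S \<subseteq> permutations_of_set (set xs)"
      by blast
    show "card ((\<lambda>p. map p xs) ` ?S) = card (permutations_of_set (set xs))"
      using card_permutations[of "set xs"] by (simp add: card_image[OF inj])
  qed simp
  thus ?thesis
    using sum.reindex[OF inj, of f] by (simp add: o_def)
qed

text \<open>Splits off the first entry. The condition on \<open>card A\<close> encodes finiteness
  and nonemptiness at once, so it can be discharged by counting.\<close>

lemma sum_permutations_of_set_nonempty:
  assumes "card A \<noteq> 0"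
  shows "(\<Sum>xs\<in>permutations_of_set A. f xs) =
    (\<Sum>x\<in>A. \<Sum>xs\<in>permutations_of_set (A - {x}). f (x # xs))"
proof -
  have A: "finite A" "A \<noteq> {}" using assms card.infinite by fastforce+
  have "(\<Sum>xs\<in>permutations_of_set A. f xs) =
      (\<Sum>x\<in>A. \<Sum>xs\<in>(#) x ` permutations_of_set (A - {x}). f xs)"
    unfolding permutations_of_set_nonempty[OF A(2)]
    by (rule sum.UNION_disjoint) (use A(1) in auto)
  also have "\<dots> = (\<Sum>x\<in>A. \<Sum>xs\<in>permutations_of_set (A - {x}). f (x # xs))"
    by (simp add: sum.reindex)
  finally show ?thesis .
qed

lemma insert_Diff_notin: "x \<notin> B \<Longrightarrow> insert x A - B = insert x (A - B)"
  by auto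

text \<open>Nested sums over explicit finite sets can be written out by rewriting, which turns the
  120 permutations into a concrete polynomial expression.\<close>

lemma sum_permutes_5:
  fixes F :: "nat \<Rightarrow> nat \<Rightarrow> nat \<Rightarrow> nat \<Rightarrow> nat \<Rightarrow> 'a :: comm_monoid_add"
  defines "A \<equiv> {1..5}"
  shows "(\<Sum>p | p permutes A. F (p 1) (p 2) (p 3) (p 4) (p 5)) =
    (\<Sum>a\<in>A. \<Sum>b\<in>A-{a}. \<Sum>c\<in>A-{a}-{b}. \<Sum>d\<in>A-{a}-{b}-{c}. \<Sum>e\<in>A-{a}-{b}-{c}-{d}. F a b c d e)"
proof -
  have A: "card A = 5" "finite A" "set [1,2,3,4,5] = A"
    by (auto simp: A_def)
  define f where "f ys = F (ys ! 0) (ys ! 1) (ys ! 2) (ys ! 3) (ys ! 4)" for ys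
  \<comment> \<open>Each use peels off the next list entry below one more summation sign; the
    cardinality condition follows from \<open>card A = 5\<close>.\<close>
  note step = sum.cong[OF refl trans[OF sum_permutations_of_set_nonempty]]
  have nil: "permutations_of_set (A-{a}-{b}-{c}-{d}-{e}) = {[]}"
    if "a \<in> A" "b \<in> A-{a}" "c \<in> A-{a}-{b}" "d \<in> A-{a}-{b}-{c}" "e \<in> A-{a}-{b}-{c}-{d}" for a b c d e
  proof -
    have "card (A-{a}-{b}-{c}-{d}-{e}) = 0"
      using that by (simp only: card_Diff_singleton A)
    thus ?thesis
      using A(2) by (simp only: card_0_eq finite_Diff permutations_of_set_empty)
  qed
  have "(\<Sum>p | p permutes A. F (p 1) (p 2) (p 3) (p 4) (p 5)) = (\<Sum>ys\<in>permutations_of_set A. f ys)"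
    using sum_permutes_set[of "[1,2,3,4,5]" f, unfolded A(3)] by (simp add: f_def)
  also have "\<dots> = (\<Sum>a\<in>A. \<Sum>b\<in>A-{a}. \<Sum>c\<in>A-{a}-{b}. \<Sum>d\<in>A-{a}-{b}-{c}. \<Sum>e\<in>A-{a}-{b}-{c}-{d}.
      f [a,b,c,d,e])"
    by (rule trans[OF sum_permutations_of_set_nonempty], simp add: A,
        (rule step, (simp add: A; fail))+, rule sum.cong[OF refl], simp only: nil) simp
  finally show ?thesis
    by (simp add: f_def)
qed

subsection \<open>Sextics with a root at infinity\<close>

text \<open>
  These are the Igusa--Clebsch invariants of the binary sextic
  \<open>z (c0 x\<^sup>5 + c1 x\<^sup>4 z + \<dots> + c5 z\<^sup>5)\<close>; in particular \<open>quintic_I10\<close> is \<open>c0\<^sup>2\<close> times the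
  discriminant of the quintic.  Their coefficients were found by linear algebra from the values at
  random integer roots.
\<close>

definition quintic_I2 :: "complex \<Rightarrow> complex \<Rightarrow> complex \<Rightarrow> complex \<Rightarrow> complex \<Rightarrow> complex \<Rightarrow> complex" where
  "quintic_I2 c0 c1 c2 c3 c4 c5 =
     40 * c0 * c4 - 16 * c1 * c3 + 6 * c2^2"

definition quintic_I4 :: "complex \<Rightarrow> complex \<Rightarrow> complex \<Rightarrow> complex \<Rightarrow> complex \<Rightarrow> complex \<Rightarrow> complex" where
  "quintic_I4 c0 c1 c2 c3 c4 c5 =
     300 * c0^2 * c3 * c5 - 80 * c0^2 * c4^2 - 180 * c0 * c1 * c2 * c5 + 4 * c0 * c1 * c3 * c4
     + 36 * c0 * c2^2 * c4 - 12 * c0 * c2 * c3^2 + 48 * c1^3 * c5 - 12 * c1^2 * c2 * c4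
     + 4 * c1^2 * c3^2"

definition quintic_I6 :: "complex \<Rightarrow> complex \<Rightarrow> complex \<Rightarrow> complex \<Rightarrow> complex \<Rightarrow> complex \<Rightarrow> complex" where
  "quintic_I6 c0 c1 c2 c3 c4 c5 =
     2250 * c0^3 * c2 * c5^2 + 1600 * c0^3 * c3 * c4 * c5 - 320 * c0^3 * c4^3
     - 900 * c0^2 * c1^2 * c5^2 - 1860 * c0^2 * c1 * c2 * c4 * c5 - 640 * c0^2 * c1 * c3^2 * c5
     + 64 * c0^2 * c1 * c3 * c4^2 + 330 * c0^2 * c2^2 * c3 * c5 + 176 * c0^2 * c2^2 * c4^2
     + 26 * c0^2 * c2 * c3^2 * c4 - 36 * c0^2 * c3^4 + 616 * c0 * c1^3 * c4 * c5
     + 492 * c0 * c1^2 * c2 * c3 * c5 + 26 * c0 * c1^2 * c2 * c4^2 + 28 * c0 * c1^2 * c3^2 * c4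
     - 198 * c0 * c1 * c2^3 * c5 - 238 * c0 * c1 * c2^2 * c3 * c4 + 76 * c0 * c1 * c2 * c3^3
     + 72 * c0 * c2^4 * c4 - 24 * c0 * c2^3 * c3^2 - 160 * c1^4 * c3 * c5 - 36 * c1^4 * c4^2
     + 60 * c1^3 * c2^2 * c5 + 76 * c1^3 * c2 * c3 * c4 - 24 * c1^3 * c3^3
     - 24 * c1^2 * c2^3 * c4 + 8 * c1^2 * c2^2 * c3^2"

definition quintic_I10 :: "complex \<Rightarrow> complex \<Rightarrow> complex \<Rightarrow> complex \<Rightarrow> complex \<Rightarrow> complex \<Rightarrow> complex" where
  "quintic_I10 c0 c1 c2 c3 c4 c5 =
     3125 * c0^6 * c5^4 - 2500 * c0^5 * c1 * c4 * c5^3 - 3750 * c0^5 * c2 * c3 * c5^3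
     + 2000 * c0^5 * c2 * c4^2 * c5^2 + 2250 * c0^5 * c3^2 * c4 * c5^2
     - 1600 * c0^5 * c3 * c4^3 * c5 + 256 * c0^5 * c4^5 + 2000 * c0^4 * c1^2 * c3 * c5^3
     - 50 * c0^4 * c1^2 * c4^2 * c5^2 + 2250 * c0^4 * c1 * c2^2 * c5^3
     - 2050 * c0^4 * c1 * c2 * c3 * c4 * c5^2 + 160 * c0^4 * c1 * c2 * c4^3 * c5
     - 900 * c0^4 * c1 * c3^3 * c5^2 + 1020 * c0^4 * c1 * c3^2 * c4^2 * c5
     - 192 * c0^4 * c1 * c3 * c4^4 - 900 * c0^4 * c2^3 * c4 * c5^2
     + 825 * c0^4 * c2^2 * c3^2 * c5^2 + 560 * c0^4 * c2^2 * c3 * c4^2 * c5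
     - 128 * c0^4 * c2^2 * c4^4 - 630 * c0^4 * c2 * c3^3 * c4 * c5
     + 144 * c0^4 * c2 * c3^2 * c4^3 + 108 * c0^4 * c3^5 * c5 - 27 * c0^4 * c3^4 * c4^2
     - 1600 * c0^3 * c1^3 * c2 * c5^3 + 160 * c0^3 * c1^3 * c3 * c4 * c5^2
     - 36 * c0^3 * c1^3 * c4^3 * c5 + 1020 * c0^3 * c1^2 * c2^2 * c4 * c5^2
     + 560 * c0^3 * c1^2 * c2 * c3^2 * c5^2 - 746 * c0^3 * c1^2 * c2 * c3 * c4^2 * c5
     + 144 * c0^3 * c1^2 * c2 * c4^4 + 24 * c0^3 * c1^2 * c3^3 * c4 * c5
     - 6 * c0^3 * c1^2 * c3^2 * c4^3 - 630 * c0^3 * c1 * c2^3 * c3 * c5^2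
     + 24 * c0^3 * c1 * c2^3 * c4^2 * c5 + 356 * c0^3 * c1 * c2^2 * c3^2 * c4 * c5
     - 80 * c0^3 * c1 * c2^2 * c3 * c4^3 - 72 * c0^3 * c1 * c2 * c3^4 * c5
     + 18 * c0^3 * c1 * c2 * c3^3 * c4^2 + 108 * c0^3 * c2^5 * c5^2
     - 72 * c0^3 * c2^4 * c3 * c4 * c5 + 16 * c0^3 * c2^4 * c4^3 + 16 * c0^3 * c2^3 * c3^3 * c5
     - 4 * c0^3 * c2^3 * c3^2 * c4^2 + 256 * c0^2 * c1^5 * c5^3
     - 192 * c0^2 * c1^4 * c2 * c4 * c5^2 - 128 * c0^2 * c1^4 * c3^2 * c5^2
     + 144 * c0^2 * c1^4 * c3 * c4^2 * c5 - 27 * c0^2 * c1^4 * c4^4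
     + 144 * c0^2 * c1^3 * c2^2 * c3 * c5^2 - 6 * c0^2 * c1^3 * c2^2 * c4^2 * c5
     - 80 * c0^2 * c1^3 * c2 * c3^2 * c4 * c5 + 18 * c0^2 * c1^3 * c2 * c3 * c4^3
     + 16 * c0^2 * c1^3 * c3^4 * c5 - 4 * c0^2 * c1^3 * c3^3 * c4^2
     - 27 * c0^2 * c1^2 * c2^4 * c5^2 + 18 * c0^2 * c1^2 * c2^3 * c3 * c4 * c5
     - 4 * c0^2 * c1^2 * c2^3 * c4^3 - 4 * c0^2 * c1^2 * c2^2 * c3^3 * c5
     + c0^2 * c1^2 * c2^2 * c3^2 * c4^2"

text \<open>Comparison of coefficients. The factors are \<open>x + w i\<close>, so
  \<open>w i\<close> is the negative of a root and no alternating signs occur; squared differences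
  are unaffected by this sign.\<close>

lemma viete_quintic:
  fixes w :: "nat \<Rightarrow> complex"
  assumes "(\<Prod>i\<in>{1..5}. [:w i, 1:]) = [:c5, c4, c3, c2, c1, 1:]"
  shows "c1 = w 1 + w 2 + w 3 + w 4 + w 5"
    and "c2 = w 1 * w 2 + w 1 * w 3 + w 1 * w 4 + w 1 * w 5 + w 2 * w 3 + w 2 * w 4 + w 2 * w 5 +
      w 3 * w 4 + w 3 * w 5 + w 4 * w 5"
    and "c3 = w 1 * w 2 * w 3 + w 1 * w 2 * w 4 + w 1 * w 2 * w 5 + w 1 * w 3 * w 4 + w 1 * w 3 * w 5 +
      w 1 * w 4 * w 5 + w 2 * w 3 * w 4 + w 2 * w 3 * w 5 + w 2 * w 4 * w 5 + w 3 * w 4 * w 5"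
    and "c4 = w 1 * w 2 * w 3 * w 4 + w 1 * w 2 * w 3 * w 5 + w 1 * w 2 * w 4 * w 5 +
      w 1 * w 3 * w 4 * w 5 + w 2 * w 3 * w 4 * w 5"
    and "c5 = w 1 * w 2 * w 3 * w 4 * w 5"
proof -
  have ivl: "{1..5::nat} = {1,2,3,4,5}" by auto
  have "[:w 1,1:]*([:w 2,1:]*([:w 3,1:]*([:w 4,1:]*[:w 5,1:]))) = [:c5, c4, c3, c2, c1, 1:]"
    using assms unfolding ivl by (simp del: mult_pCons_left mult_pCons_right)
  thus "c1 = w 1 + w 2 + w 3 + w 4 + w 5"
    and "c2 = w 1 * w 2 + w 1 * w 3 + w 1 * w 4 + w 1 * w 5 + w 2 * w 3 + w 2 * w 4 + w 2 * w 5 +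
      w 3 * w 4 + w 3 * w 5 + w 4 * w 5"
    and "c3 = w 1 * w 2 * w 3 + w 1 * w 2 * w 4 + w 1 * w 2 * w 5 + w 1 * w 3 * w 4 + w 1 * w 3 * w 5 +
      w 1 * w 4 * w 5 + w 2 * w 3 * w 4 + w 2 * w 3 * w 5 + w 2 * w 4 * w 5 + w 3 * w 4 * w 5"
    and "c4 = w 1 * w 2 * w 3 * w 4 + w 1 * w 2 * w 3 * w 5 + w 1 * w 2 * w 4 * w 5 +
      w 1 * w 3 * w 4 * w 5 + w 2 * w 3 * w 4 * w 5"
    and "c5 = w 1 * w 2 * w 3 * w 4 * w 5"
    by (simp_all add: algebra_simps)
qed

text \<open>
  The identity for \<open>quintic_I10\<close> in five roots is reduced to the case of a vanishing root because
  its direct expansion is too slow.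
\<close>

lemma quintic_I10_shift:
  "quintic_I10 1 (e1 + 5*t) (e2 + 4*e1*t + 10*t^2) (e3 + 3*e2*t + 6*e1*t^2 + 10*t^3)
     (e4 + 2*e3*t + 3*e2*t^2 + 4*e1*t^3 + 5*t^4) (e4*t + e3*t^2 + e2*t^3 + e1*t^4 + t^5) =
   quintic_I10 1 e1 e2 e3 e4 0"
  by (simp only: quintic_I10_def power_one mult_1_left mult_1_right power_zero_numeral
      mult_zero_left mult_zero_right add_0_left add_0_right diff_zero) Groebner_Basis.algebra

text \<open>When one root is 0, the discriminant is that of the remaining quartic times the squared
  product of its roots.\<close>

lemma quintic_I10_zero_root:
  "quintic_I10 1 (z1 + z2 + z3 + z4) (z1*z2 + z1*z3 + z1*z4 + z2*z3 + z2*z4 + z3*z4)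
     (z1*z2*z3 + z1*z2*z4 + z1*z3*z4 + z2*z3*z4) (z1*z2*z3*z4) 0 =
   ((z1-z2) * (z1-z3) * (z1-z4) * (z2-z3) * (z2-z4) * (z3-z4) * z1 * z2 * z3 * z4)^2"
  by (simp only: quintic_I10_def power_one mult_1_left mult_1_right power_zero_numeral
      mult_zero_left mult_zero_right add_0_left add_0_right diff_zero) Groebner_Basis.algebra

section \<open>Symmetric functions of the five finite roots\<close>

context
  fixes w :: "nat \<Rightarrow> complex" and c1 c2 c3 c4 c5
  assumes "(\<Prod>i\<in>{1..5}. [:w i, 1:]) = [:c5, c4, c3, c2, c1, 1:]"
begin

lemma ivl5: "{1..5::nat} = {1,2,3,4,5}"
  by auto

lemmas viete = viete_quintic[OF \<open>(\<Prod>i\<in>{1..5}. [:w i, 1:]) = [:c5, c4, c3, c2, c1, 1:]\<close>]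

lemmas sum_5_simps = ivl5 sum.insert sum.empty finite.intros insert_Diff_notin insert_Diff1 empty_Diff
  insert_iff empty_iff finite_Diff finite_insert simp_thms add_0_right rel_simps

text \<open>The factors 8, 12 and 2 here and in the next two sums are the orders of the stabilizers
  of the summand among the permutations of five points. Multiplied by the 6 positions of the root at
  infinity they give 48, 72 and 12.\<close>

lemma quintic_I2_sum:
  "(\<Sum>p | p permutes {1..5}. (w (p 1) - w (p 2))\<^sup>2 * (w (p 3) - w (p 4))\<^sup>2) = 8 * quintic_I2 1 c1 c2 c3 c4 c5"
  unfolding sum_permutes_5[of "\<lambda>a b c d e. (w a - w b)\<^sup>2 * (w c - w d)\<^sup>2"]
    quintic_I2_def viete power_one mult_1_left mult_1_right
  by (simp only: sum_5_simps) Groebner_Basis.algebra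

lemma quintic_I4_sum:
  "(\<Sum>p | p permutes {1..5}. (w (p 1) - w (p 2))\<^sup>2 * (w (p 2) - w (p 3))\<^sup>2 *
     (w (p 3) - w (p 1))\<^sup>2 * (w (p 4) - w (p 5))\<^sup>2) = 12 * quintic_I4 1 c1 c2 c3 c4 c5"
  unfolding sum_permutes_5[of "\<lambda>a b c d e. (w a - w b)\<^sup>2 * (w b - w c)\<^sup>2 * (w c - w a)\<^sup>2 * (w d - w e)\<^sup>2"]
    quintic_I4_def viete power_one mult_1_left mult_1_right
  by (simp only: sum_5_simps) Groebner_Basis.algebra

lemma quintic_I6_sum:
  "(\<Sum>p | p permutes {1..5}. (w (p 1) - w (p 2))\<^sup>2 * (w (p 2) - w (p 3))\<^sup>2 *
     (w (p 3) - w (p 1))\<^sup>2 * (w (p 4) - w (p 5))\<^sup>2 * (w (p 1) - w (p 4))\<^sup>2 * (w (p 2) - w (p 5))\<^sup>2) =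
   2 * quintic_I6 1 c1 c2 c3 c4 c5"
  unfolding sum_permutes_5[of "\<lambda>a b c d e. (w a - w b)\<^sup>2 * (w b - w c)\<^sup>2 * (w c - w a)\<^sup>2 *
      (w d - w e)\<^sup>2 * (w a - w d)\<^sup>2 * (w b - w e)\<^sup>2"]
    quintic_I6_def viete power_one mult_1_left mult_1_right
  by (simp only: sum_5_simps) Groebner_Basis.algebra

lemma quintic_I10_prod: "(\<Prod>j\<in>{1..5}. \<Prod>i\<in>{1..<j}. (w i - w j)\<^sup>2) = quintic_I10 1 c1 c2 c3 c4 c5"
proof -
  \<comment> \<open>Translating by \<open>t\<close> moves the fifth root to 0, and \<open>z\<close>
    holds the other four.\<close>
  define t where "t = w 5"
  define z where "z i = w i - t" for i
  have w: "w 1 = z 1 + t" "w 2 = z 2 + t" "w 3 = z 3 + t" "w 4 = z 4 + t" "w 5 = t"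
    by (simp_all add: z_def t_def)
  define e1 e2 e3 e4 where "e1 = z 1 + z 2 + z 3 + z 4"
    and "e2 = z 1*z 2 + z 1*z 3 + z 1*z 4 + z 2*z 3 + z 2*z 4 + z 3*z 4"
    and "e3 = z 1*z 2*z 3 + z 1*z 2*z 4 + z 1*z 3*z 4 + z 2*z 3*z 4" and "e4 = z 1*z 2*z 3*z 4"
  \<comment> \<open>These are the coefficients of
    \<open>x^5 + e1 x^4 + e2 x^3 + e3 x^2 + e4 x\<close> after replacing \<open>x\<close> by
    \<open>x + t\<close>.\<close>
  have c: "c1 = e1 + 5*t" "c2 = e2 + 4*e1*t + 10*t^2" "c3 = e3 + 3*e2*t + 6*e1*t^2 + 10*t^3"
     "c4 = e4 + 2*e3*t + 3*e2*t^2 + 4*e1*t^3 + 5*t^4" "c5 = e4*t + e3*t^2 + e2*t^3 + e1*t^4 + t^5"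
    unfolding viete w e1_def e2_def e3_def e4_def by Groebner_Basis.algebra+
  have ivls: "{1..<1} = ({}::nat set)" "{1..<2} = {1::nat}" "{1..<3} = {1,2::nat}"
      "{1..<4} = {1,2,3::nat}" "{1..<5} = {1,2,3,4::nat}"
    by auto
  have "(\<Prod>j\<in>{1..5}. \<Prod>i\<in>{1..<j}. (w i - w j)\<^sup>2) =
    ((z 1-z 2) * (z 1-z 3) * (z 1-z 4) * (z 2-z 3) * (z 2-z 4) * (z 3-z 4) * z 1 * z 2 * z 3 * z 4)^2"
    unfolding ivl5 by (simp add: ivls w power_mult_distrib mult_ac del: One_nat_def)
  thus ?thesis
    unfolding c quintic_I10_shift by (simp only: e1_def e2_def e3_def e4_def quintic_I10_zero_root)
qed

end

text \<open>Index 6 is the point at infinity, whose brackets with finite points square to 1. All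
  brackets occur squared, so signs do not matter. Symmetries of each term move the index that meets
  infinity to position 6, which leaves sums over five points.\<close>

lemma igusa_clebsch_sums_quintic:
  fixes d :: "nat \<Rightarrow> nat \<Rightarrow> complex"
  assumes c: "(\<Prod>i\<in>{1..5}. [:w i, 1:]) = [:c5, c4, c3, c2, c1, 1:]"
    and d: "\<And>i j. (d i j)\<^sup>2 = (d j i)\<^sup>2"
    and w: "\<And>i j. i \<in> {1..5} \<Longrightarrow> j \<in> {1..5} \<Longrightarrow> (d i j)\<^sup>2 = (w i - w j)\<^sup>2"
    and inf: "\<And>i. i \<in> {1..5} \<Longrightarrow> (d i 6)\<^sup>2 = 1"
  shows "igusa_clebsch_sums d =
    (quintic_I2 1 c1 c2 c3 c4 c5, quintic_I4 1 c1 c2 c3 c4 c5,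
     quintic_I6 1 c1 c2 c3 c4 c5, quintic_I10 1 c1 c2 c3 c4 c5)"
proof -
  define T2 :: "(nat \<Rightarrow> nat \<Rightarrow> complex) \<Rightarrow> complex" where
    "T2 b = (b 1 2)\<^sup>2 * (b 3 4)\<^sup>2 * (b 5 6)\<^sup>2" for b
  define T4 :: "(nat \<Rightarrow> nat \<Rightarrow> complex) \<Rightarrow> complex" where
    "T4 b = (b 1 2)\<^sup>2 * (b 2 3)\<^sup>2 * (b 3 1)\<^sup>2 * (b 4 5)\<^sup>2 * (b 5 6)\<^sup>2 * (b 6 4)\<^sup>2" for b
  define T6 :: "(nat \<Rightarrow> nat \<Rightarrow> complex) \<Rightarrow> complex" where
    "T6 b = (b 1 2)\<^sup>2 * (b 2 3)\<^sup>2 * (b 3 1)\<^sup>2 * (b 4 5)\<^sup>2 * (b 5 6)\<^sup>2 * (b 6 4)\<^sup>2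
          * (b 1 4)\<^sup>2 * (b 2 5)\<^sup>2 * (b 3 6)\<^sup>2" for b
  have ivl: "{1..6} - {6} = {1..5::nat}" by auto
  have ivl7: "{1..6::nat} = insert 6 {1..5}" by auto
  \<comment> \<open>A symmetry of the term \<open>T\<close> that carries position \<open>k\<close>
    to 6, valid for brackets symmetric up to sign.\<close>
  define aut where "aut T k \<longleftrightarrow> (\<exists>g. g permutes {1..6::nat} \<and> g k = 6 \<and>
      (\<forall>b. (\<forall>i j. (b i j)\<^sup>2 = (b j i)\<^sup>2) \<longrightarrow> T (\<lambda>i j. b (g i) (g j)) = T b))"
    for T :: "(nat \<Rightarrow> nat \<Rightarrow> complex) \<Rightarrow> complex" and k
  have reduce: "(\<Sum>\<sigma> | \<sigma> permutes {1..6}. T (\<lambda>i j. d (\<sigma> i) (\<sigma> j))) =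
      6 * (\<Sum>p | p permutes {1..5}. T (\<lambda>i j. d (p i) (p j)))"
    if T: "\<And>k. k \<in> {1..6} \<Longrightarrow> aut T k"
    for T :: "(nat \<Rightarrow> nat \<Rightarrow> complex) \<Rightarrow> complex"
  proof -
    have "\<exists>g. g permutes {1..6} \<and> g k = 6 \<and>
        (\<forall>\<sigma>. T (\<lambda>i j. d ((\<sigma> \<circ> g) i) ((\<sigma> \<circ> g) j)) = T (\<lambda>i j. d (\<sigma> i) (\<sigma> j)))" if k: "k \<in> {1..6}" for k
    proof -
      obtain g where g: "g permutes {1..6}" "g k = 6"
        "\<And>b. (\<And>i j. (b i j)\<^sup>2 = (b j i)\<^sup>2) \<Longrightarrow> T (\<lambda>i j. b (g i) (g j)) = T b"
        using T[OF k] unfolding aut_def by blast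
      show ?thesis
        using g(1,2) g(3)[of "\<lambda>i j. d (_ i) (_ j)", OF d] by auto
    qed
    from sum_permutes_transitive[of "{1..6}" 6, OF _ _ this, unfolded ivl] show ?thesis
      by simp
  qed
  \<comment> \<open>The edges \<open>ij\<close> for the brackets \<open>b i j\<close> in \<open>T6\<close> form a triangular prism, whose automorphism group is
    transitive on the vertices; so we may assume that the root at infinity is at vertex 6.\<close>
  define r :: "nat \<Rightarrow> nat" where "r = transpose 3 6 \<circ> transpose 1 4 \<circ> transpose 2 5"
  \<comment> \<open>The edges of \<open>T4\<close> are the two triangles 123 and 456 of the prism of
    \<open>T6\<close>, so the same symmetries serve both terms. Reflections move 4 and 5 to 6, and
    \<open>r\<close> interchanges the triangles.\<close>
  have sym: "aut T4 k" "aut T6 k" if k: "k \<in> {1..6}" for k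
  proof -
    let ?P = "\<lambda>k g. g permutes {1..6::nat} \<and> g k = 6 \<and> (\<forall>b :: nat \<Rightarrow> nat \<Rightarrow> complex. (\<forall>i j. (b i j)\<^sup>2 = (b j i)\<^sup>2) \<longrightarrow>
      T4 (\<lambda>i j. b (g i) (g j)) = T4 b \<and> T6 (\<lambda>i j. b (g i) (g j)) = T6 b)"
    have "?P 6 id" using permutes_id[of "{1..6::nat}"] by (simp add: id_def)
    moreover have "?P 5 (transpose 5 6 \<circ> transpose 2 3)"
      by (intro conjI permutes_compose permutes_swap_id allI impI; simp add: T4_def T6_def transpose_def mult_ac)
    moreover have "?P 4 (transpose 4 6 \<circ> transpose 1 3)"
      by (intro conjI permutes_compose permutes_swap_id allI impI; simp add: T4_def T6_def transpose_def mult_ac)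
    moreover have "?P 3 r"
      unfolding r_def
      by (intro conjI permutes_compose permutes_swap_id allI impI; simp add: T4_def T6_def transpose_def mult_ac)
    moreover have "?P 2 (transpose 5 6 \<circ> transpose 2 3 \<circ> r)"
      unfolding r_def
      by (intro conjI permutes_compose permutes_swap_id allI impI; simp add: T4_def T6_def transpose_def mult_ac)
    moreover have "?P 1 (transpose 4 6 \<circ> transpose 1 3 \<circ> r)"
      unfolding r_def
      by (intro conjI permutes_compose permutes_swap_id allI impI; simp add: T4_def T6_def transpose_def mult_ac)
    moreover have "k = 1 \<or> k = 2 \<or> k = 3 \<or> k = 4 \<or> k = 5 \<or> k = 6"
      using k by auto
    ultimately have "\<exists>g. ?P k g"
      by blast
    thus "aut T4 k" "aut T6 k"
      unfolding aut_def by blast+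
  qed
  \<comment> \<open>The graph of \<open>T2\<close> is the perfect matching 12, 34, 56: its edges can
    be interchanged and the ends of an edge swapped.\<close>
  have sym2: "aut T2 k" if k: "k \<in> {1..6}" for k
  proof -
    let ?P = "\<lambda>k g. g permutes {1..6::nat} \<and> g k = 6 \<and> (\<forall>b :: nat \<Rightarrow> nat \<Rightarrow> complex. (\<forall>i j. (b i j)\<^sup>2 = (b j i)\<^sup>2) \<longrightarrow>
      T2 (\<lambda>i j. b (g i) (g j)) = T2 b)"
    have "?P 6 id" using permutes_id[of "{1..6::nat}"] by (simp add: id_def)
    moreover have "?P 5 (transpose 5 6)"
      by ((intro conjI permutes_compose permutes_swap_id allI impI; simp add: T2_def transpose_def mult_ac)+)
    moreover have "?P 4 (transpose 4 6 \<circ> transpose 3 5)" "?P 3 (transpose 3 6 \<circ> transpose 4 5)"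
      "?P 2 (transpose 2 6 \<circ> transpose 1 5)" "?P 1 (transpose 1 6 \<circ> transpose 2 5)"
      by ((intro conjI permutes_compose permutes_swap_id allI impI; simp add: T2_def transpose_def mult_ac)+)
    moreover have "k = 1 \<or> k = 2 \<or> k = 3 \<or> k = 4 \<or> k = 5 \<or> k = 6"
      using k by auto
    ultimately show ?thesis
      unfolding aut_def by blast
  qed
  have p: "p 6 = 6" "\<And>i. i \<in> {1..5} \<Longrightarrow> p i \<in> {1..5}" if "p permutes {1..5}" for p :: "nat \<Rightarrow> nat"
    using that permutes_not_in[of p "{1..5}" 6] permutes_in_image[OF that] by auto
  have d5: "(d (p i) (p j))\<^sup>2 = (w (p i) - w (p j))\<^sup>2"
    if "p permutes {1..5}" "i \<in> {1..5}" "j \<in> {1..5}" for p i j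
    by (rule w[OF p(2)[OF that(1,2)] p(2)[OF that(1,3)]])
  have d6: "(d (p i) (p 6))\<^sup>2 = 1" "(d (p 6) (p i))\<^sup>2 = 1"
    if "p permutes {1..5}" "i \<in> {1..5}" for p i
    unfolding p(1)[OF that(1)] d[of 6] using inf[OF p(2)[OF that]] by simp_all
  have "(\<Sum>\<sigma> | \<sigma> permutes {1..6}. T2 (\<lambda>i j. d (\<sigma> i) (\<sigma> j))) / 48 = quintic_I2 1 c1 c2 c3 c4 c5"
  proof -
    have "(\<Sum>p | p permutes {1..5}. T2 (\<lambda>i j. d (p i) (p j))) = 8 * quintic_I2 1 c1 c2 c3 c4 c5"
      unfolding quintic_I2_sum[OF c, symmetric] T2_def
      by (rule sum.cong) (simp_all add: d5 d6)
    thus ?thesis using reduce[of T2, OF sym2] by simp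
  qed
  moreover have "(\<Sum>\<sigma> | \<sigma> permutes {1..6}. T4 (\<lambda>i j. d (\<sigma> i) (\<sigma> j))) / 72 = quintic_I4 1 c1 c2 c3 c4 c5"
  proof -
    have "(\<Sum>p | p permutes {1..5}. T4 (\<lambda>i j. d (p i) (p j))) = 12 * quintic_I4 1 c1 c2 c3 c4 c5"
      unfolding quintic_I4_sum[OF c, symmetric] T4_def
      by (rule sum.cong) (simp_all add: d5 d6)
    thus ?thesis using reduce[of T4, OF sym(1)] by simp
  qed
  moreover have "(\<Sum>\<sigma> | \<sigma> permutes {1..6}. T6 (\<lambda>i j. d (\<sigma> i) (\<sigma> j))) / 12 = quintic_I6 1 c1 c2 c3 c4 c5"
  proof -
    have "(\<Sum>p | p permutes {1..5}. T6 (\<lambda>i j. d (p i) (p j))) = 2 * quintic_I6 1 c1 c2 c3 c4 c5"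
      unfolding quintic_I6_sum[OF c, symmetric] T6_def
      by (rule sum.cong) (simp_all add: d5 d6)
    thus ?thesis using reduce[of T6, OF sym(2)] by simp
  qed
  moreover have "(\<Prod>j\<in>{1..6}. \<Prod>i\<in>{1..<j}. (d i j)\<^sup>2) = quintic_I10 1 c1 c2 c3 c4 c5"
  proof -
    have "(\<Prod>i\<in>{1..<6}. (d i 6)\<^sup>2) = 1"
      by (rule prod.neutral) (use inf in auto)
    moreover have "(\<Prod>j\<in>{1..5}. \<Prod>i\<in>{1..<j}. (d i j)\<^sup>2) = quintic_I10 1 c1 c2 c3 c4 c5"
      unfolding quintic_I10_prod[OF c, symmetric]
      by (intro prod.cong refl w) auto
    ultimately show ?thesis
      unfolding ivl7 by simp
  qed
  ultimately show ?thesis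
    unfolding igusa_clebsch_sums_def Let_def T2_def T4_def T6_def by blast
qed

subsection \<open>Moving a root to infinity\<close>

text \<open>Homogeneity of degrees 2, 4, 6 and 10 in the coefficients, which reduces a general
  leading coefficient to the monic case.\<close>

lemma quintic_scale:
  "quintic_I2 c (c * c1) (c * c2) (c * c3) (c * c4) (c * c5) = c^2 * quintic_I2 1 c1 c2 c3 c4 c5"
  "quintic_I4 c (c * c1) (c * c2) (c * c3) (c * c4) (c * c5) = c^4 * quintic_I4 1 c1 c2 c3 c4 c5"
  "quintic_I6 c (c * c1) (c * c2) (c * c3) (c * c4) (c * c5) = c^6 * quintic_I6 1 c1 c2 c3 c4 c5"
  "quintic_I10 c (c * c1) (c * c2) (c * c3) (c * c4) (c * c5) = c^10 * quintic_I10 1 c1 c2 c3 c4 c5"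
  unfolding quintic_I2_def quintic_I4_def quintic_I6_def quintic_I10_def power_one mult_1_left mult_1_right
  by Groebner_Basis.algebra+

lemma ex_linear_factors:
  fixes f :: "complex poly"
  assumes "Polynomial.degree f = n"
  shows "\<exists>w. f = smult (lead_coeff f) (\<Prod>i\<in>{1..n}. [:w i, 1:])"
  using assms
proof (induction n arbitrary: f)
  case 0
  then show ?case
    by (auto elim: degree_eq_zeroE)
next
  case (Suc n)
  obtain r where "poly f r = 0"
    using fundamental_theorem_of_algebra[of f] Suc.prems by (auto simp: constant_degree)
  then obtain g where g: "f = [:- r, 1:] * g"
    by (auto simp: poly_eq_0_iff_dvd)
  have "g \<noteq> 0"
    using g Suc.prems by auto
  hence "Polynomial.degree g = n"
    using Suc.prems unfolding g by (simp add: degree_mult_eq del: mult_pCons_left)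
  moreover have lead: "lead_coeff f = lead_coeff g"
    unfolding g lead_coeff_mult by simp
  ultimately obtain w where w: "g = smult (lead_coeff g) (\<Prod>i\<in>{1..n}. [:w i, 1:])"
    using Suc.IH by blast
  have "f = smult (lead_coeff f) ((\<Prod>i\<in>{1..n}. [:w i, 1:]) * [:- r, 1:])"
    unfolding lead by (subst g, subst w) (simp add: mult_ac del: mult_pCons_left mult_pCons_right)
  also have "(\<Prod>i\<in>{1..n}. [:w i, 1:]) * [:- r, 1:] = (\<Prod>i\<in>{1..Suc n}. [:(w(Suc n := - r)) i, 1:])"
    by (simp del: mult_pCons_left mult_pCons_right)
  finally show ?case
    by blast
qed

lemma igusa_clebsch_quintic:
  assumes c0: "c0 \<noteq> 0"
  shows "igusa_clebsch [:c5, c4, c3, c2, c1, c0:] =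
    (quintic_I2 c0 c1 c2 c3 c4 c5, quintic_I4 c0 c1 c2 c3 c4 c5,
     quintic_I6 c0 c1 c2 c3 c4 c5, quintic_I10 c0 c1 c2 c3 c4 c5)"
proof -
  let ?f = "[:c5, c4, c3, c2, c1, c0:]"
  have deg: "Polynomial.degree ?f = 5" and lead: "lead_coeff ?f = c0"
    using c0 by auto
  obtain w :: "nat \<Rightarrow> complex" where w: "?f = smult c0 (\<Prod>i\<in>{1..5}. [:w i, 1:])"
    using ex_linear_factors[OF deg] unfolding lead by blast
  hence "(\<Prod>i\<in>{1..5}. [:w i, 1:]) = smult (inverse c0) ?f"
    using c0 by simp
  hence prod: "(\<Prod>i\<in>{1..5}. [:w i, 1:]) = [:c5 / c0, c4 / c0, c3 / c0, c2 / c0, c1 / c0, 1:]"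
    using c0 by (simp add: divide_inverse mult.commute)
  \<comment> \<open>Index 6 with \<open>u = 0\<close>, \<open>v = - 1\<close> contributes the
    constant factor 1, that is, the root at infinity. The leading coefficient is put into this
    factor through \<open>k\<close>.\<close>
  define u v k :: "nat \<Rightarrow> complex" where "u i = (if i = 6 then 0 else 1)" and "v i = (if i = 6 then - 1 else - w i)"
    and "k i = (if i = 6 then c0 else 1)" for i
  have ivl: "{1..6::nat} = insert 6 {1..5}"
    by auto
  have k: "(\<Prod>i\<in>{1..6}. k i) = c0"
    unfolding ivl by (simp add: k_def)
  have "(\<Prod>i\<in>{1..6}. [:- (k i * v i), k i * u i:]) = [:c0:] * (\<Prod>i\<in>{1..5}. [:w i, 1:])"
    unfolding ivl by (simp add: k_def u_def v_def)
  hence "sextic_factorization ?f (\<lambda>i. k i * u i) (\<lambda>i. k i * v i)"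
    unfolding sextic_factorization_def w by simp
  hence "igusa_clebsch ?f = igusa_clebsch_sums (\<lambda>i j. k i * v i * (k j * u j) - k j * v j * (k i * u i))"
    by (rule igusa_clebsch_eqI[rotated]) (use c0 in simp)
  also have "\<dots> = igusa_clebsch_sums (\<lambda>i j. k i * k j * (v i * u j - v j * u i))"
    by (simp add: algebra_simps)
  also have "\<dots> = (quintic_I2 c0 c1 c2 c3 c4 c5, quintic_I4 c0 c1 c2 c3 c4 c5,
     quintic_I6 c0 c1 c2 c3 c4 c5, quintic_I10 c0 c1 c2 c3 c4 c5)"
  proof -
    have "igusa_clebsch_sums (\<lambda>i j. v i * u j - v j * u i) =
        (quintic_I2 1 (c1/c0) (c2/c0) (c3/c0) (c4/c0) (c5/c0), quintic_I4 1 (c1/c0) (c2/c0) (c3/c0) (c4/c0) (c5/c0),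
         quintic_I6 1 (c1/c0) (c2/c0) (c3/c0) (c4/c0) (c5/c0), quintic_I10 1 (c1/c0) (c2/c0) (c3/c0) (c4/c0) (c5/c0))"
      by (rule igusa_clebsch_sums_quintic[OF prod]) (auto simp: u_def v_def power2_commute)
    thus ?thesis
      unfolding igusa_clebsch_sums_scale k Let_def using c0 by (simp add: quintic_scale[symmetric])
  qed
  finally show ?thesis .
qed

text \<open>Covariance under the Moebius map \<open>x\<close> to \<open>r + s / x\<close>, of
  determinant \<open>- s\<close>: every bracket is multiplied by \<open>- s\<close>, and the
  constant \<open>\<kappa>\<close> is absorbed into one of the six linear factors.\<close>

lemma igusa_clebsch_inversion:
  assumes f: "f \<noteq> 0" "Polynomial.degree f \<le> 6" and s: "s \<noteq> 0" and \<kappa>: "\<kappa> \<noteq> 0"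
    and g: "\<And>x. x \<noteq> 0 \<Longrightarrow> poly g x = \<kappa> * x ^ 6 * poly f (r + s / x)"
  shows "igusa_clebsch g = (case igusa_clebsch f of (i2, i4, i6, i10) \<Rightarrow>
    let t = \<kappa> * s ^ 3 in (t^2 * i2, t^4 * i4, t^6 * i6, t^10 * i10))"
proof -
  obtain u v where uv: "sextic_factorization f u v"
    using ex_sextic_factorization[OF f(2)] by blast
  define k where "k i = (if i = 1 then \<kappa> else 1)" for i :: nat
  have k: "(\<Prod>i\<in>{1..6}. k i) = \<kappa>"
    unfolding ivl6 by (simp add: k_def)
  \<comment> \<open>Obtained from \<open>x * (u i * (r + s / x) - v i) = (u i * r - v i) * x + s * u
    i\<close>.\<close>
  define u' v' where "u' i = k i * (u i * r - v i)" and "v' i = - (k i * s * u i)" for i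
  have eq: "poly g x = poly (\<Prod>i\<in>{1..6}. [:- v' i, u' i:]) x" if x: "x \<noteq> 0" for x
  proof -
    have "poly g x = (\<Prod>i\<in>{1..6}. k i) * (\<Prod>i\<in>{1..6::nat}. x) * (\<Prod>i\<in>{1..6}. u i * (r + s / x) - v i)"
      unfolding g[OF x] k using uv by (simp add: sextic_factorization_def poly_prod algebra_simps)
    also have "\<dots> = (\<Prod>i\<in>{1..6}. k i * x * (u i * (r + s / x) - v i))"
      by (simp only: prod.distrib)
    also have "\<dots> = poly (\<Prod>i\<in>{1..6}. [:- v' i, u' i:]) x"
    proof -
      define y where "y = s / x"
      have "s = x * y"
        using x by (simp add: y_def)
      thus ?thesis
        unfolding poly_prod by (simp add: u'_def v'_def algebra_simps)
    qed
    finally show ?thesis .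
  qed
  have "g = (\<Prod>i\<in>{1..6}. [:- v' i, u' i:])"
  \<comment> \<open>Both polynomials agree at the infinitely many points
    \<open>x \<noteq> 0\<close>.\<close>
  proof (rule ccontr)
    assume ne: "g \<noteq> (\<Prod>i\<in>{1..6}. [:- v' i, u' i:])"
    have "- {0} \<subseteq> {x. poly (g - (\<Prod>i\<in>{1..6}. [:- v' i, u' i:])) x = 0}"
      using eq by auto
    moreover have "finite {x. poly (g - (\<Prod>i\<in>{1..6}. [:- v' i, u' i:])) x = 0}"
      using ne by (intro poly_roots_finite) auto
    ultimately have "finite (- {0::complex})"
      using finite_subset by blast
    thus False
      using infinite_UNIV_char_0[where 'a = complex] by (simp add: finite_compl)
  qed
  hence fac: "sextic_factorization g u' v'"
    by (simp add: sextic_factorization_def)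
  have "g \<noteq> 0"
  proof
    assume "g = 0"
    have "poly f (r + y) = 0" if "y \<noteq> 0" for y
      using g[of "s / y"] that s \<kappa> \<open>g = 0\<close> by simp
    from this[of "x - r" for x] have "- {r} \<subseteq> {x. poly f x = 0}"
      by auto
    moreover have "finite {x. poly f x = 0}"
      using f(1) by (rule poly_roots_finite)
    ultimately have "finite (- {r})"
      using finite_subset by blast
    thus False
      using infinite_UNIV_char_0[where 'a = complex] by (simp add: finite_compl)
  qed
  \<comment> \<open>A square root of \<open>- s\<close> distributes the common bracket factor evenly
    over the two points, as the scaling lemma requires. The resulting sign of the product disappears
    in even powers.\<close>
  define \<sigma> where "\<sigma> = csqrt (- s)"
  have \<sigma>: "\<sigma> ^ 2 = - s"
    by (simp add: \<sigma>_def)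
  have prod: "(\<Prod>i\<in>{1..6}. \<sigma> * k i) = - (\<kappa> * s ^ 3)"
  proof -
    have "(\<Prod>i\<in>{1..6}. \<sigma> * k i) = (\<sigma> ^ 2) ^ 3 * \<kappa>"
      by (simp only: prod.distrib k) (simp flip: power_mult)
    thus ?thesis
      by (simp add: \<sigma> power3_eq_cube)
  qed
  have "igusa_clebsch g = igusa_clebsch_sums (\<lambda>i j. v' i * u' j - v' j * u' i)"
    by (rule igusa_clebsch_eqI[OF \<open>g \<noteq> 0\<close> fac])
  also have "(\<lambda>i j. v' i * u' j - v' j * u' i) = (\<lambda>i j. (\<sigma> * k i) * (\<sigma> * k j) * (v i * u j - v j * u i))"
  proof -
    have "v' i * u' j - v' j * u' i = (- s) * (k i * k j * (v i * u j - v j * u i))" for i j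
      by (simp add: u'_def v'_def algebra_simps)
    thus ?thesis
      unfolding \<sigma>[symmetric] by (simp add: power2_eq_square mult_ac)
  qed
  finally show ?thesis
    unfolding igusa_clebsch_sums_scale prod igusa_clebsch_eqI[OF f(1) uv] by (simp add: Let_def)
qed

subsection \<open>The Weierstrass model\<close>

lemma squarefree_imp_simple_root:
  fixes f :: "'a :: field poly"
  assumes "squarefree f" "poly f x = 0"
  shows "poly (pderiv f) x \<noteq> 0"
proof
  assume "poly (pderiv f) x = 0"
  obtain g where g: "f = [:- x, 1:] * g"
    using assms(2) by (auto simp: poly_eq_0_iff_dvd)
  have "poly g x = 0"
    using \<open>poly (pderiv f) x = 0\<close> unfolding g pderiv_mult by (simp add: pderiv_pCons)
  then obtain h where "g = [:- x, 1:] * h"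
    by (auto simp: poly_eq_0_iff_dvd)
  hence "[:- x, 1:]\<^sup>2 dvd f"
    by (simp only: g power2_eq_square mult.assoc[symmetric] dvd_triv_left)
  hence "is_unit [:- x, 1:]"
    using assms(1) by (simp add: squarefree_def)
  thus False
    by (simp add: is_unit_pCons_iff)
qed

section \<open>Invariants of the quintic of Taylor coefficients\<close>

context
  fixes s q \<nu> b1 b2 b3 b4 b5 :: complex
  assumes root: "s^6 - 2 * s^5 - 10 * q * s^3 - 2 * \<nu> * q^2 * s - q^2 * (\<nu> - 5) = 0"
    and b1: "b1 = 6 * s^5 - 10 * s^4 - 30 * q * s^2 - 2 * \<nu> * q^2"
    and b2: "b2 = 15 * s^4 - 20 * s^3 - 30 * q * s"
    and b3: "b3 = 20 * s^3 - 20 * s^2 - 10 * q"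
    and b4: "b4 = 15 * s^2 - 10 * s"
    and b5: "b5 = 6 * s - 2"
begin

lemmas eval_simps = b1 b2 b3 b4 b5 power_one mult_1_left mult_1_right

text \<open>In this and the next three values the two sides differ by a multiple of the left side of
  \<open>root\<close>. The list \<open>b1, ..., b5, 1\<close> starts with the linear Taylor
  coefficient because inversion reverses the order.\<close>

lemma I2_value: "quintic_I2 b1 b2 b3 b4 b5 1 = 200 * q^2 * (2 * \<nu> - 3)"
  using root unfolding quintic_I2_def eval_simps by Groebner_Basis.algebra

lemma I4_value: "quintic_I4 b1 b2 b3 b4 b5 1 = 2500 * q^4 * (\<nu> - 9)^2"
  using root unfolding quintic_I4_def eval_simps by Groebner_Basis.algebra

text \<open>The combination \<open>(\<nu> - 5)^2 + \<nu>^3 * q^2\<close> is kept apart because it is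
  the part that later becomes a multiple of \<open>m\<close>.\<close>

lemma I6_value: "quintic_I6 b1 b2 b3 b4 b5 1 =
    5000 * q^5 * (q * (75 * \<nu>^3 - 1165 * \<nu>^2 + 5985 * \<nu> - 6399) + 36 * ((\<nu> - 5)^2 + \<nu>^3 * q^2))"
  using root unfolding quintic_I6_def eval_simps by Groebner_Basis.algebra

lemma I10_value: "quintic_I10 b1 b2 b3 b4 b5 1 =
    200000 * q^8 * ((\<nu> - 5)^2 + \<nu>^3 * q^2 + 2 * q * (5 * \<nu>^2 - 45 * \<nu> + 108))^2"
  using root unfolding quintic_I10_def eval_simps by Groebner_Basis.algebra

lemmas quintic_values = I2_value I4_value I6_value I10_value

end

text \<open>If \<open>P\<close> were zero, its rescaling \<open>Q\<close> would be zero too.\<close>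

lemma same_point_1235I:
  assumes "Q \<noteq> (0, 0, 0, 0)" "c \<noteq> 0"
    and "case P of (a1, a2, a3, a5) \<Rightarrow> Q = (c * a1, c^2 * a2, c^3 * a3, c^5 * a5)"
  shows "same_point_1235 P Q"
  using assms unfolding same_point_1235_def by (cases P) auto

theorem proposition6p3:
  fixes k :: "complex set" and m n :: complex
  assumes "subfield k (ring_of_type_algebra :: complex ring)"
    and "complex_of_real (sqrt 5) \<in> k"
    and "m \<in> k" and "n \<in> k"
    and "genus2_weierstrass (weierstrass_sextic m n)"
  shows "let \<nu> = m^2 - 5 * n^2 in
    same_point_1235 (igusa_clebsch (weierstrass_sextic m n))
      (20 * (2 * \<nu> - 3),
       25 * (\<nu> - 9)^2,
       5 * (75 * \<nu>^3 + 72 * m * \<nu>^2 - 1165 * \<nu>^2 - 360 * m * \<nu> + 5985 * \<nu> - 6399),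
       8 * (m * \<nu>^2 + 5 * \<nu>^2 - 5 * m * \<nu> - 45 * \<nu> + 108)^2)"
proof -
  define f where "f = weierstrass_sextic m n"
  define \<nu> where "\<nu> = m^2 - 5 * n^2"
  define \<rho> where "\<rho> = complex_of_real (sqrt 5)"
  define A B where "A = m + n * \<rho>" and "B = m - n * \<rho>"
  have "\<rho>^2 = 5"
    unfolding \<rho>_def by (simp flip: of_real_power)
  moreover have "A * B = m^2 - n^2 * \<rho>^2"
    unfolding A_def B_def by Groebner_Basis.algebra
  ultimately have \<nu>: "\<nu> = A * B"
    by (simp add: \<nu>_def)
  have m: "2 * m = A + B"
    by (simp add: A_def B_def)
  have f: "f = [:- ((\<nu> - 5)^3 * A^2), - (2 * \<nu> * (\<nu> - 5)^2 * A), 0, - (10 * \<nu> * (\<nu> - 5)), 0,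
      - (2 * \<nu> * B), B^2:]"
    unfolding f_def weierstrass_sextic_def Let_def \<nu>_def A_def B_def \<rho>_def ..
  have sqf: "squarefree f" and deg: "Polynomial.degree f \<in> {5, 6}"
    using assms(5) by (simp_all add: genus2_weierstrass_def f_def)
  \<comment> \<open>If \<open>B = 0\<close>, then \<open>\<nu> = 0\<close> and \<open>f\<close>
    collapses to a constant.\<close>
  have "B \<noteq> 0"
    using deg by (auto simp: f \<nu>)
  \<comment> \<open>Otherwise the two lowest coefficients vanish and 0 is a double root.\<close>
  have "A \<noteq> 0" "\<nu> - 5 \<noteq> 0"
    using squarefree_imp_simple_root[OF sqf, of 0] by (auto simp: f \<nu> pderiv_pCons)
  have "f \<noteq> 0"
    using deg by auto
  define q where "q = (\<nu> - 5) / (A^2 * B)"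
  have q: "\<nu> - 5 = q * A^2 * B" "q \<noteq> 0"
    using \<open>A \<noteq> 0\<close> \<open>B \<noteq> 0\<close> \<open>\<nu> - 5 \<noteq> 0\<close> by (simp_all add: q_def)
  define F where "F y = y^6 - 2 * y^5 - 10 * q * y^3 - 2 * \<nu> * q^2 * y - q^2 * (\<nu> - 5)" for y
  have fF: "poly f (A * y) = B^2 * A^6 * F y" for y
    unfolding f F_def q(1) unfolding \<nu> by simp Groebner_Basis.algebra
  obtain x where "poly f x = 0"
    using fundamental_theorem_of_algebra[of f] deg by (auto simp: constant_degree)
  define s where "s = x / A"
  have x: "x = A * s"
    using \<open>A \<noteq> 0\<close> by (simp add: s_def)
  have root: "F s = 0"
    using \<open>poly f x = 0\<close> \<open>A \<noteq> 0\<close> \<open>B \<noteq> 0\<close> by (simp add: x fF)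
  define c1 c2 c3 c4 c5 where
    "c1 = 6 * s^5 - 10 * s^4 - 30 * q * s^2 - 2 * \<nu> * q^2"
    and "c2 = 15 * s^4 - 20 * s^3 - 30 * q * s"
    and "c3 = 20 * s^3 - 20 * s^2 - 10 * q"
    and "c4 = 15 * s^2 - 10 * s" and "c5 = 6 * s - 2"
  note c_defs = c1_def c2_def c3_def c4_def c5_def
  \<comment> \<open>By the chain rule, with \<open>c1\<close> the derivative of \<open>F\<close> at
    \<open>s\<close>. Simplicity of the root makes \<open>c1\<close> nonzero, so the inverted
    polynomial has degree exactly 5.\<close>
  have "poly (pderiv f) x = B^2 * A^5 * c1"
    unfolding f x c_defs q(1) unfolding \<nu> by (simp add: pderiv_pCons) Groebner_Basis.algebra
  hence "c1 \<noteq> 0"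
    using squarefree_imp_simple_root[OF sqf \<open>poly f x = 0\<close>] by auto
  \<comment> \<open>Homogenized so that putting \<open>y = 1 / x\<close> makes each
    \<open>x * y\<close> equal to 1.\<close>
  have Taylor: "x^6 * F (s + y) = x^6 * F s + c1 * x^5 * (x * y) + c2 * x^4 * (x * y)^2 + c3 * x^3 * (x * y)^3 +
      c4 * x^2 * (x * y)^4 + c5 * x * (x * y)^5 + (x * y)^6" for x y
    unfolding F_def c_defs by Groebner_Basis.algebra
  define \<kappa> where "\<kappa> = 1 / (B^2 * A^6)"
  \<comment> \<open>The map \<open>y\<close> to \<open>A * s + A / y\<close> sends infinity to the
    chosen root of \<open>f\<close>, and \<open>\<kappa>\<close> cancels the factor
    \<open>B^2 * A^6\<close> from \<open>fF\<close>.\<close>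
  have "igusa_clebsch [:1, c5, c4, c3, c2, c1:] = (case igusa_clebsch f of (i2, i4, i6, i10) \<Rightarrow>
    let t = \<kappa> * A ^ 3 in (t^2 * i2, t^4 * i4, t^6 * i6, t^10 * i10))"
  proof (rule igusa_clebsch_inversion[OF \<open>f \<noteq> 0\<close> _ \<open>A \<noteq> 0\<close>])
    show "Polynomial.degree f \<le> 6"
      using deg by auto
    show "\<kappa> \<noteq> 0"
      using \<open>A \<noteq> 0\<close> \<open>B \<noteq> 0\<close> by (simp add: \<kappa>_def)
    show "poly [:1, c5, c4, c3, c2, c1:] y = \<kappa> * y ^ 6 * poly f (A * s + A / y)" if "y \<noteq> 0" for y
    proof -
      have "\<kappa> * y ^ 6 * poly f (A * s + A / y) = y ^ 6 * F (s + 1 / y)"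
        using fF[of "s + 1 / y"] \<open>A \<noteq> 0\<close> \<open>B \<noteq> 0\<close> by (simp add: \<kappa>_def distrib_left)
      also have "\<dots> = poly [:1, c5, c4, c3, c2, c1:] y"
        unfolding Taylor using that by (simp add: root) Groebner_Basis.algebra
      finally show ?thesis ..
    qed
  qed
  moreover define K where "K = B^2 * A^3"
  hence K: "\<kappa> * A ^ 3 = 1 / K" "K \<noteq> 0"
    using \<open>A \<noteq> 0\<close> \<open>B \<noteq> 0\<close> by (simp_all add: \<kappa>_def field_simps)
  \<comment> \<open>Solves the inversion formula for the invariants of \<open>f\<close>.\<close>
  have "i = K^j * T" if "(1 / K)^j * i = T" for i T and j :: nat
    unfolding that[symmetric] using \<open>K \<noteq> 0\<close> by (simp add: power_one_over)
  moreover note igusa_clebsch_quintic[OF \<open>c1 \<noteq> 0\<close>, of 1 c5 c4 c3 c2, unfolded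
    quintic_values[OF root[unfolded F_def] c1_def c2_def c3_def c4_def c5_def]]
  ultimately have I: "igusa_clebsch f =
    (K^2 * (200 * q^2 * (2 * \<nu> - 3)), K^4 * (2500 * q^4 * (\<nu> - 9)^2),
     K^6 * (5000 * q^5 * (q * (75 * \<nu>^3 - 1165 * \<nu>^2 + 5985 * \<nu> - 6399) + 36 * ((\<nu> - 5)^2 + \<nu>^3 * q^2))),
     K^10 * (200000 * q^8 * ((\<nu> - 5)^2 + \<nu>^3 * q^2 + 2 * q * (5 * \<nu>^2 - 45 * \<nu> + 108))^2))"
    unfolding Let_def K(1) by (simp only: prod.inject split: prod.splits)
  \<comment> \<open>Chosen to turn the constant 200 of the first coordinate into 20. The others then
    become 2500/10^2 = 25, 5000/10^3 = 5 and 800000/10^5 = 8.\<close>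
  define c where "c = 1 / (10 * (K * q)^2)"
  have c: "c * K^2 * q^2 = 1 / 10" "c \<noteq> 0"
    using \<open>K \<noteq> 0\<close> \<open>q \<noteq> 0\<close> by (simp_all add: c_def field_simps)
  \<comment> \<open>Here \<open>m\<close> enters through \<open>2 * m = A + B\<close>: by
    \<open>\<nu> - 5 = q * A^2 * B\<close>, the summand with \<open>A\<close> gives
    \<open>(\<nu> - 5)^2\<close> and the one with \<open>B\<close> gives
    \<open>\<nu>^3 * q^2\<close>.\<close>
  have mq: "(\<nu> - 5)^2 + \<nu>^3 * q^2 = 2 * q * (m * \<nu> * (\<nu> - 5))"
  proof -
    have "2 * q * (m * \<nu> * (\<nu> - 5)) = q * (A + B) * \<nu> * (\<nu> - 5)"
      unfolding m[symmetric] by simp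
    also have "\<dots> = (\<nu> - 5)^2 + \<nu>^3 * q^2"
      unfolding q(1) unfolding \<nu> by Groebner_Basis.algebra
    finally show ?thesis ..
  qed
  have scale2: "c * (K^2 * (200 * q^2 * (2 * \<nu> - 3))) = (c * K^2 * q^2) * (200 * (2 * \<nu> - 3))"
    by Groebner_Basis.algebra
  have scale4: "c^2 * (K^4 * (2500 * q^4 * (\<nu> - 9)^2)) = (c * K^2 * q^2)^2 * (2500 * (\<nu> - 9)^2)"
    by Groebner_Basis.algebra
  \<comment> \<open>Here and in \<open>scale10\<close>, \<open>e\<close> stands for
    \<open>m * \<nu> * (\<nu> - 5)\<close> and \<open>h\<close> for the remaining polynomial in
    \<open>\<nu>\<close>.\<close>
  have scale6: "c^3 * (K^6 * (5000 * q^5 * (q * h + 36 * (2 * q * e)))) =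
      (c * K^2 * q^2)^3 * (5000 * (h + 72 * e))" for h e
    by Groebner_Basis.algebra
  have scale10: "c^5 * (K^10 * (200000 * q^8 * (2 * q * e + 2 * q * h)^2)) =
      (c * K^2 * q^2)^5 * (800000 * (e + h)^2)" for h e
    by Groebner_Basis.algebra
  let ?P = "igusa_clebsch f" and ?Q = "(20 * (2 * \<nu> - 3), 25 * (\<nu> - 9)^2,
       5 * (75 * \<nu>^3 + 72 * m * \<nu>^2 - 1165 * \<nu>^2 - 360 * m * \<nu> + 5985 * \<nu> - 6399),
       8 * (m * \<nu>^2 + 5 * \<nu>^2 - 5 * m * \<nu> - 45 * \<nu> + 108)^2)"
  have PQ: "case ?P of (a1, a2, a3, a5) \<Rightarrow> ?Q = (c * a1, c^2 * a2, c^3 * a3, c^5 * a5)"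
    unfolding I mq prod.case scale2 scale4 scale6 scale10 c(1)
    by (simp add: power_divide) (simp add: algebra_simps power2_eq_square power3_eq_cube)
  \<comment> \<open>The first coordinate vanishes only for \<open>\<nu> = 3/2\<close>, the second
    only for \<open>\<nu> = 9\<close>.\<close>
  have "?Q \<noteq> (0, 0, 0, 0)"
    by auto
  from same_point_1235I[OF this c(2) PQ] have "same_point_1235 ?P ?Q" .
  thus ?thesis
    unfolding f_def \<nu>_def Let_def .
qed

end
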